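(* Let $K\in\mathcal{M}_n(\mathbb{R})$ be symmetric positive semi-definite with eigenvalues $\lambda=(\lambda_1,\dots,\lambda_n)\in[0,1]^n$ and write $K=PD(\lambda)P^T$ (with $P$ an $n\times n$ real orthogonal matrix) for the spectral decomposition of $K$. Let $\mu=(\mu_1,\dots,\mu_n)\in\mathbb{R}_+^n$ and $\nu=(\nu_1,\dots,\nu_n)\in\mathbb{R}_+^n$ be such that for every $i\in[n]$ \[\left(\lambda_i-\tfrac12\right)^2+\frac{1}{2}\left(\mu_i^2+\nu_i^2+|\mu_i-\nu_i|\sqrt{4\left(\lambda_i-\tfrac{1}{2}\right)^2+(\mu_i+\nu_i)^2}\right)\leq\frac14,\] and define the matrices $A=PD(\mu)P^T$ and $B=-PD(\nu)P^T$ (so $A$ and $-B$ are symmetric positive semi-definite). Then \[\mathbb{K}=\begin{pmatrix}K & A\\ B & K\end{pmatrix}\in\mathcal{M}_{2n}(\mathbb{R})\] is a DPP kernel.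
   Context: $\mathbb{R}_+=[0,\infty)$; for $m\ge1$, $[m]=\{1,\dots,m\}$ and $\mathcal{M}_m(\mathbb{R})$ is the set of real $m\times m$ matrices; $D(x)$ is the diagonal matrix with diagonal entries the coordinates of $x$. For a matrix $N\in\mathcal{M}_m(\mathbb{R})$ and $S\subset[m]$, $N_S$ is the principal submatrix of $N$ with rows and columns indexed by $S$, with $\det(N_\emptyset)=1$. The determinantal measure with kernel $N$ is the unique signed measure $\rho$ on the power set $\mathcal{P}([m])$ such that $\rho(\{X\in\mathcal{P}([m]): S\subset X\})=\det(N_S)$ for all $S\subset[m]$. $N$ is called a DPP kernel if this $\rho$ is a probability measure. Kernels are not assumed symmetric. *)

theory Defs
  imports "HOL-Analysis.Analysis"
begin

definition diag_mat :: "real^'n \<Rightarrow> real^'n^'n" where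
  "diag_mat x = (\<chi> i j. if i = j then x $ i else 0)"

definition pos_semidef :: "real^'n^'n \<Rightarrow> bool" where
  "pos_semidef N \<longleftrightarrow> transpose N = N \<and> (\<forall>x. 0 \<le> x \<bullet> (N *v x))"

text \<open>The rows and columns of a \<open>2n \<times> 2n\<close> matrix are indexed by the sum type
  \<open>'n + 'n\<close>, where \<open>Inl\<close> is the first block of indices and \<open>Inr\<close> the second.\<close>

definition block_mat ::
  "real^'n^'n \<Rightarrow> real^'n^'n \<Rightarrow> real^'n^'n \<Rightarrow> real^'n^'n \<Rightarrow> real^('n + 'n)^('n + 'n)" where
  "block_mat A B C D = (\<chi> i j.
     case i of
       Inl a \<Rightarrow> (case j of Inl b \<Rightarrow> A $ a $ b | Inr b \<Rightarrow> B $ a $ b)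
     | Inr a \<Rightarrow> (case j of Inl b \<Rightarrow> C $ a $ b | Inr b \<Rightarrow> D $ a $ b))"

text \<open>The size of a matrix of type \<open>real^'m^'m\<close> is given by its type, so the principal submatrix
  indexed by a set \<open>S\<close> is not itself of such a type. Its determinant is defined by the Leibniz
  formula that defines \<^const>\<open>det\<close>, over the permutations of \<open>S\<close> instead of those of
  \<^term>\<open>UNIV\<close>.\<close>

definition principal_minor :: "real^'m^'m \<Rightarrow> 'm set \<Rightarrow> real" where
  "principal_minor N S = (\<Sum>p | p permutes S. of_int (sign p) * (\<Prod>i\<in>S. N $ i $ p i))"

lemma principal_minor_empty: "principal_minor N {} = 1"
  by (simp add: principal_minor_def)

lemma principal_minor_UNIV: "principal_minor N UNIV = det N"
  by (simp add: principal_minor_def det_def)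

definition signed_measure :: "'a set set \<Rightarrow> ('a set \<Rightarrow> real) \<Rightarrow> bool" where
  "signed_measure M \<rho> \<longleftrightarrow>
     \<rho> {} = 0 \<and>
     (\<forall>A::nat \<Rightarrow> 'a set. range A \<subseteq> M \<longrightarrow> disjoint_family A \<longrightarrow> \<Union>(range A) \<in> M \<longrightarrow>
        (\<lambda>i. \<rho> (A i)) sums \<rho> (\<Union>(range A)))"

text \<open>On the finite space of all subsets of \<open>'m\<close>, every family of subsets is an event, so the
  sigma-algebra is \<^term>\<open>UNIV\<close>.\<close>

definition is_determinantal :: "real^'m^'m \<Rightarrow> ('m set set \<Rightarrow> real) \<Rightarrow> bool" where
  "is_determinantal N \<rho> \<longleftrightarrow>
     signed_measure UNIV \<rho> \<and> (\<forall>S. \<rho> {X. S \<subseteq> X} = principal_minor N S)"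

definition determinantal_measure :: "real^'m^'m \<Rightarrow> 'm set set \<Rightarrow> real" where
  "determinantal_measure N = (THE \<rho>. is_determinantal N \<rho>)"

definition DPP_kernel :: "real^'m^'m \<Rightarrow> bool" where
  "DPP_kernel N \<longleftrightarrow>
     (\<forall>A. 0 \<le> determinantal_measure N A) \<and> determinantal_measure N UNIV = 1"

lemma signed_measure_finite_iff:
  fixes \<rho> :: "('a::finite) set \<Rightarrow> real"
  shows "signed_measure UNIV \<rho> \<longleftrightarrow> (\<forall>A. \<rho> A = (\<Sum>x\<in>A. \<rho> {x}))"
proof
  assume sm: "signed_measure UNIV \<rho>"
  have emp: "\<rho> {} = 0" using sm by (simp add: signed_measure_def)
  have add: "\<rho> (A \<union> B) = \<rho> A + \<rho> B" if "A \<inter> B = {}" for A B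
  proof -
    have "disjoint_family (binaryset A B)"
      using that by (auto simp: disjoint_family_on_def binaryset_def)
    then have "(\<lambda>i. \<rho> (binaryset A B i)) sums \<rho> (\<Union>(range (binaryset A B)))"
      using sm unfolding signed_measure_def by blast
    then have "(\<lambda>i. \<rho> (binaryset A B i)) sums \<rho> (A \<union> B)"
      by (simp only: UN_binaryset_eq)
    moreover have "(\<lambda>i. \<rho> (binaryset A B i)) sums (\<rho> A + \<rho> B)"
      by (rule binaryset_sums) (rule emp)
    ultimately show ?thesis by (rule sums_unique2)
  qed
  show "\<forall>A. \<rho> A = (\<Sum>x\<in>A. \<rho> {x})"
  proof
    fix A :: "'a set"
    have "finite A" by simp
    then show "\<rho> A = (\<Sum>x\<in>A. \<rho> {x})"
    proof induction
      case empty then show ?case using emp by simp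
    next
      case (insert x F)
      then show ?case using add[of "{x}" F] by simp
    qed
  qed
next
  assume r: "\<forall>A. \<rho> A = (\<Sum>x\<in>A. \<rho> {x})"
  have "(\<lambda>i. \<rho> (A i)) sums \<rho> (\<Union>(range A))" if d: "disjoint_family A" for A :: "nat \<Rightarrow> 'a set"
  proof -
    have "(\<lambda>i. \<Sum>x\<in>UNIV. if x \<in> A i then \<rho> {x} else 0)
        sums (\<Sum>x\<in>UNIV. if x \<in> \<Union>(range A) then \<rho> {x} else 0)"
    proof (rule sums_sum)
      fix x
      show "(\<lambda>i. if x \<in> A i then \<rho> {x} else 0) sums (if x \<in> \<Union>(range A) then \<rho> {x} else 0)"
      proof (cases "x \<in> \<Union>(range A)")
        case True
        then obtain k where k: "x \<in> A k" by auto
        have "(\<lambda>i. if x \<in> A i then \<rho> {x} else 0) = (\<lambda>i. if i = k then \<rho> {x} else 0)"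
          using d k by (auto simp: disjoint_family_on_def fun_eq_iff)
        then show ?thesis using True sums_single[of k "\<lambda>_. \<rho> {x}"] by simp
      next
        case False
        then show ?thesis by simp
      qed
    qed
    moreover have eq: "\<rho> B = (\<Sum>x\<in>UNIV. if x \<in> B then \<rho> {x} else 0)" for B
      by (subst spec[OF r, of B]) (simp add: sum.If_cases)
    ultimately show ?thesis by (subst (1 2) eq)
  qed
  moreover have "\<rho> {} = 0" by (subst spec[OF r, of "{}"]) simp
  ultimately show "signed_measure UNIV \<rho>" by (simp add: signed_measure_def)
qed

lemma superset_sums_ex1:
  fixes h :: "('m::finite) set \<Rightarrow> real"
  shows "\<exists>!g. \<forall>S. (\<Sum>X | S \<subseteq> X. g X) = h S"
proof -
  define L :: "real^('m set) \<Rightarrow> real^('m set)" where "L g = (\<chi> S. \<Sum>X | S \<subseteq> X. g $ X)" for g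
  have lin: "linear L"
    by (rule linearI) (auto simp: L_def vec_eq_iff sum.distrib sum_distrib_left)
  have ker: "g = 0" if "L g = 0" for g
  proof -
    have s: "(\<Sum>X | S \<subseteq> X. g $ X) = 0" for S
      using that by (auto simp: L_def vec_eq_iff)
    have "g $ S = 0" for S
    proof (induction S rule: measure_induct_rule[where f = "\<lambda>S. card (- S)"])
      case (less S)
      have "g $ X = 0" if "S \<subset> X" for X
        using that by (intro less psubset_card_mono) auto
      moreover have "{X. S \<subseteq> X} = insert S {X. S \<subset> X}" by auto
      ultimately show ?case using s[of S] by simp
    qed
    then show ?thesis by (simp add: vec_eq_iff)
  qed
  have inj: "inj L" using lin ker linear_injective_0 by blast
  then have "surj L" using lin linear_injective_imp_surjective by blast
  then obtain g where g: "L g = (\<chi> S. h S)" unfolding surj_def by metis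
  show ?thesis
  proof (rule ex1I[of _ "\<lambda>X. g $ X"])
    show "\<forall>S. (\<Sum>X | S \<subseteq> X. g $ X) = h S"
      using g by (auto simp: L_def vec_eq_iff)
  next
    fix g' assume "\<forall>S. (\<Sum>X | S \<subseteq> X. g' X) = h S"
    then have "L (\<chi> X. g' X) = L g" using g by (auto simp: L_def vec_eq_iff)
    then have "(\<chi> X. g' X) = g" using inj by (simp add: inj_eq)
    then show "g' = (\<lambda>X. g $ X)" by auto
  qed
qed

lemma is_determinantal_ex1: "\<exists>!\<rho>. is_determinantal N \<rho>"
proof -
  have ex: "\<exists>!g. \<forall>S. (\<Sum>X | S \<subseteq> X. g X) = principal_minor N S"
    by (rule superset_sums_ex1)
  then obtain g where g: "\<And>S. (\<Sum>X | S \<subseteq> X. g X) = principal_minor N S" by auto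
  show ?thesis
  proof (rule ex1I[of _ "\<lambda>A. \<Sum>X\<in>A. g X"])
    show "is_determinantal N (\<lambda>A. \<Sum>X\<in>A. g X)"
      using g by (simp add: is_determinantal_def signed_measure_finite_iff)
  next
    fix \<rho> assume "is_determinantal N \<rho>"
    then have r: "\<And>A. \<rho> A = (\<Sum>X\<in>A. \<rho> {X})"
      and m: "\<And>S. \<rho> {X. S \<subseteq> X} = principal_minor N S"
      unfolding is_determinantal_def signed_measure_finite_iff by blast+
    have "\<And>S. (\<Sum>X | S \<subseteq> X. \<rho> {X}) = principal_minor N S" using r m by (simp flip: r)
    then have "(\<lambda>X. \<rho> {X}) = g" using ex g by blast
    then have "g X = \<rho> {X}" for X by auto
    then show "\<rho> = (\<lambda>A. \<Sum>X\<in>A. g X)" by (simp add: fun_eq_iff flip: r)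
  qed
qed

lemma is_determinantal_determinantal_measure: "is_determinantal N (determinantal_measure N)"
  unfolding determinantal_measure_def by (rule theI'[OF is_determinantal_ex1])

end

theory Submission
  imports Defs
begin

text \<open>The theorem is a case of a criterion for real square matrices: \<open>N\<close> is a DPP kernel whenever
  \<open>N - I/2\<close> has operator norm at most \<open>1/2\<close>. Indeed the atoms of the determinantal measure are
  determinants. Let \<open>R\<^sub>X\<close> have the rows \<open>N\<^sub>i\<close> for \<open>i \<in> X\<close> and \<open>e\<^sub>i - N\<^sub>i\<close> for \<open>i \<notin> X\<close>. Each
  row outside \<open>S\<close> can be chosen in two ways whose sum is \<open>e\<^sub>i\<close>, so by multilinearity the
  \<open>det R\<^sub>X\<close> with \<open>S \<subseteq> X\<close> add up to the principal minor of \<open>S\<close>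
  (\<open>sum_det_atom_matrix\<close>), and the mass of \<open>{X}\<close> is \<open>det R\<^sub>X\<close>. Now
  \<open>R\<^sub>X = I/2 + J(N - I/2)\<close>, where \<open>J\<close> is diagonal with entry \<open>1\<close> on \<open>X\<close> and \<open>-1\<close> off \<open>X\<close>.
  Multiplication by \<open>J\<close> preserves norms, so if \<open>N - I/2\<close> has norm at most \<open>1/2\<close>, then
  \<open>I/2 + t J(N - I/2)\<close> is invertible for \<open>0 \<le> t < 1\<close>. Its determinant therefore keeps the positive
  sign that it has at \<open>t = 0\<close>, and \<open>det R\<^sub>X \<ge> 0\<close> (\<open>det_mat_add_nonneg\<close>).

  The orthogonal change of basis \<open>P\<close> in both blocks splits the block matrix minus \<open>I/2\<close> into
  the \<open>2 \<times> 2\<close> matrices with rows \<open>(l, \<mu>\<^sub>i)\<close> and \<open>(-\<nu>\<^sub>i, l)\<close>, where \<open>l = \<lambda>\<^sub>i - 1/2\<close>. The left side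
  of the hypothesis is exactly the largest eigenvalue of \<open>M\<^sup>T M\<close> for this matrix \<open>M\<close>, that is, the
  square of its operator norm (\<open>two_by_two_norm_bound\<close>).\<close>

section \<open>The atoms of a determinantal measure\<close>

text \<open>This is \<open>R\<^sub>X\<close> above: its determinant is the mass of the atom \<open>{X}\<close>.\<close>

definition atom_matrix :: "real^'m^'m \<Rightarrow> 'm set \<Rightarrow> real^'m^'m" where
  "atom_matrix N X = (\<chi> i j. if i \<in> X then N $ i $ j else (mat 1 :: real^'m^'m) $ i $ j - N $ i $ j)"

text \<open>If a permutation is nontrivial somewhere off \<open>S\<close>, an off-diagonal zero occurs in the product;
  this cuts the Leibniz formula down from all permutations to those of \<open>S\<close>.\<close>

lemma prod_off_diagonal_identity:
  fixes S :: "'m::finite set"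
  assumes "p permutes UNIV"
  shows "(\<Prod>i\<in>-S. (mat 1 :: real^'m^'m) $ i $ p i) = (if p permutes S then 1 else 0)"
proof (cases "p permutes S")
  case True
  then show ?thesis by (simp add: mat_def permutes_not_in)
next
  case False
  then obtain i where "i \<in> -S" "p i \<noteq> i"
    using permutes_superset[OF assms, of S] by auto
  then have "(\<Prod>i\<in>-S. (mat 1 :: real^'m^'m) $ i $ p i) = 0"
    by (intro prod_zero bexI[of _ i]) (auto simp: mat_def)
  then show ?thesis using False by simp
qed

text \<open>Both sides are the determinant of the matrix with rows \<open>N\<^sub>i\<close> for \<open>i \<in> S\<close> and \<open>e\<^sub>i\<close> for
  \<open>i \<notin> S\<close>: on the left because \<open>e\<^sub>i = N\<^sub>i + (e\<^sub>i - N\<^sub>i)\<close> and the determinant is linear in each row,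
  on the right because the rows \<open>e\<^sub>i\<close> leave only the minor of \<open>S\<close>.\<close>

lemma sum_det_atom_matrix:
  fixes N :: "real^'m^'m"
  shows "(\<Sum>X | S \<subseteq> X. det (atom_matrix N X)) = principal_minor N S"
proof -
  let ?I = "mat 1 :: real^'m^'m"
  let ?s = "\<lambda>p. of_int (sign p) :: real"
  have bij: "bij_betw (\<lambda>T. S \<union> T) (Pow (-S)) {X. S \<subseteq> X}"
    by (rule bij_betw_byWitness[where f' = "\<lambda>X. X - S"]) auto
  have split: "(\<Prod>i\<in>UNIV. atom_matrix N (S \<union> T) $ i $ p i) =
      (\<Prod>i\<in>S. N $ i $ p i) * ((\<Prod>i\<in>T. N $ i $ p i) * (\<Prod>i\<in>-S-T. ?I $ i $ p i - N $ i $ p i))"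
    if "T \<in> Pow (-S)" for T p
  proof -
    have "(UNIV :: 'm set) = S \<union> (T \<union> (-S-T))" by auto
    then have "(\<Prod>i\<in>UNIV. atom_matrix N (S \<union> T) $ i $ p i) =
        (\<Prod>i\<in>S \<union> (T \<union> (-S-T)). atom_matrix N (S \<union> T) $ i $ p i)"
      by (rule arg_cong)
    also have "\<dots> = (\<Prod>i\<in>S. atom_matrix N (S \<union> T) $ i $ p i) *
        (\<Prod>i\<in>T \<union> (-S-T). atom_matrix N (S \<union> T) $ i $ p i)"
      using that by (intro prod.union_disjoint) auto
    also have "(\<Prod>i\<in>T \<union> (-S-T). atom_matrix N (S \<union> T) $ i $ p i) =
        (\<Prod>i\<in>T. atom_matrix N (S \<union> T) $ i $ p i) * (\<Prod>i\<in>-S-T. atom_matrix N (S \<union> T) $ i $ p i)"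
      by (intro prod.union_disjoint) auto
    finally show ?thesis by (simp add: atom_matrix_def)
  qed
  have "(\<Sum>X | S \<subseteq> X. det (atom_matrix N X)) = (\<Sum>T\<in>Pow (-S). det (atom_matrix N (S \<union> T)))"
    by (rule sum.reindex_bij_betw[OF bij, symmetric])
  also have "\<dots> = (\<Sum>p | p permutes UNIV. \<Sum>T\<in>Pow (-S).
      ?s p * (\<Prod>i\<in>UNIV. atom_matrix N (S \<union> T) $ i $ p i))"
    unfolding det_def by (rule sum.swap)
  also have "\<dots> = (\<Sum>p | p permutes UNIV. ?s p * ((\<Prod>i\<in>S. N $ i $ p i) *
      (\<Prod>i\<in>-S. N $ i $ p i + (?I $ i $ p i - N $ i $ p i))))"
    unfolding prod_add[OF finite] sum_distrib_left by (simp add: split)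
  also have "\<dots> = (\<Sum>p | p permutes UNIV. if p permutes S then ?s p * (\<Prod>i\<in>S. N $ i $ p i) else 0)"
    by (intro sum.cong) (auto simp: prod_off_diagonal_identity)
  also have "\<dots> = principal_minor N S"
    unfolding principal_minor_def
    by (intro sum.mono_neutral_cong_right) (auto intro: permutes_subset)
  finally show ?thesis .
qed

lemma determinantal_measure_eq_sum_det:
  "determinantal_measure N = (\<lambda>A. \<Sum>X\<in>A. det (atom_matrix N X))"
  unfolding determinantal_measure_def
  by (rule the1_equality[OF is_determinantal_ex1])
     (simp add: is_determinantal_def signed_measure_finite_iff sum_det_atom_matrix)

lemma DPP_kernelI_det_atom_matrix:
  assumes "\<And>X. 0 \<le> det (atom_matrix N X)"
  shows "DPP_kernel N"
proof -
  have "determinantal_measure N UNIV = principal_minor N {}"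
    by (simp add: determinantal_measure_eq_sum_det flip: sum_det_atom_matrix)
  then show ?thesis
    unfolding DPP_kernel_def
    by (simp add: determinantal_measure_eq_sum_det principal_minor_empty assms sum_nonneg)
qed

section \<open>Kernels close to half the identity\<close>

lemma mat_vector_mult: "mat c *v v = c *\<^sub>R v" for v :: "real^'m"
  by (simp add: vec_eq_iff matrix_vector_mult_def mat_def if_distrib[of "\<lambda>x. x * _"] cong: if_cong)

text \<open>The determinant of \<open>c I + t C\<close> is continuous in \<open>t\<close> and positive at \<open>t = 0\<close>. A sign change
  before \<open>t = 1\<close> would give a nonzero \<open>v\<close> with \<open>c v = - t C v\<close>, whose right side is too short.\<close>

lemma det_mat_add_nonneg:
  fixes C :: "real^'m^'m"
  assumes c: "0 < c" and C: "\<And>v. norm (C *v v) \<le> c * norm v"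
  shows "0 \<le> det (mat c + C)"
proof (rule ccontr)
  define f where "f t = det (mat c + t *\<^sub>R C)" for t :: real
  assume "\<not> 0 \<le> det (mat c + C)"
  then have f1: "f 1 < 0" by (simp add: f_def)
  have "f 0 = c ^ CARD('m)"
    by (simp add: f_def det_diagonal mat_def)
  with c have f0: "0 < f 0" by simp
  have "continuous_on {0..1} f"
    unfolding f_def det_def by (intro continuous_intros)
  then obtain t where t: "0 \<le> t" "t \<le> 1" "f t = 0"
    using IVT2'[of f 1 0 0] f0 f1 by auto
  with f1 have "t < 1" by (cases "t = 1") auto
  from t have "\<not> invertible (mat c + t *\<^sub>R C)"
    by (simp add: f_def invertible_det_nz)
  then obtain v where v: "(mat c + t *\<^sub>R C) *v v = 0" "v \<noteq> 0"
    unfolding invertible_left_inverse matrix_left_invertible_ker by auto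
  have "c *\<^sub>R v = - (t *\<^sub>R (C *v v))"
  proof -
    have "(t *\<^sub>R C) *v v = t *\<^sub>R (C *v v)"
      by (simp add: scaleR_matrix_vector_assoc)
    then show ?thesis
      using v(1) by (simp add: mat_vector_mult matrix_vector_mult_add_rdistrib eq_neg_iff_add_eq_0)
  qed
  then have "norm (c *\<^sub>R v) = norm (t *\<^sub>R (C *v v))" by (metis norm_minus_cancel)
  then have "c * norm v = t * norm (C *v v)" using c t by simp
  also have "\<dots> \<le> t * (c * norm v)" using C t by (intro mult_left_mono) auto
  also have "\<dots> < 1 * (c * norm v)"
    using \<open>t < 1\<close> c v(2) by (intro mult_strict_right_mono) auto
  finally show False by simp
qed

text \<open>The atom matrices differ from \<open>I/2\<close> by \<open>N - I/2\<close> with some rows negated, and negating rows does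
  not change the norm of an image vector.\<close>

lemma DPP_kernelI_near_half:
  fixes N :: "real^'m^'m"
  assumes N: "\<And>v. norm ((N - mat (1/2)) *v v) \<le> 1/2 * norm v"
  shows "DPP_kernel N"
proof (rule DPP_kernelI_det_atom_matrix)
  fix X :: "'m set"
  let ?M = "N - mat (1/2)"
  define C where "C = (\<chi> i j. (if i \<in> X then 1 else -1) * ?M $ i $ j)"
  have "norm (C *v v) = norm (?M *v v)" for v
  proof -
    have "(C *v v) $ i = (if i \<in> X then 1 else -1) * (?M *v v) $ i" for i
      by (simp only: C_def matrix_vector_mult_def vec_lambda_beta sum_distrib_left mult.assoc)
    then have "\<bar>(C *v v) $ i\<bar> = \<bar>(?M *v v) $ i\<bar>" for i
      by (simp add: abs_mult)
    then show ?thesis by (simp add: norm_vec_def)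
  qed
  then have "0 \<le> det (mat (1/2) + C)"
    using N by (intro det_mat_add_nonneg) auto
  also have "mat (1/2) + C = atom_matrix N X"
    by (auto simp: vec_eq_iff C_def atom_matrix_def mat_def)
  finally show "0 \<le> det (atom_matrix N X)" .
qed

section \<open>The operator norm of a two-by-two matrix\<close>

lemma binary_quadratic_form_nonneg:
  fixes p q r a b :: real
  assumes "0 \<le> p" "0 \<le> q" "r\<^sup>2 \<le> p * q"
  shows "0 \<le> p * a\<^sup>2 - 2 * r * a * b + q * b\<^sup>2"
proof (cases "p = 0")
  case True
  with assms show ?thesis by simp
next
  case False
  have "p * (p * a\<^sup>2 - 2 * r * a * b + q * b\<^sup>2) = (p * a - r * b)\<^sup>2 + (p * q - r\<^sup>2) * b\<^sup>2"
    by algebra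
  also have "0 \<le> \<dots>" using assms by simp
  finally show ?thesis using False assms by (simp add: zero_le_mult_iff)
qed

text \<open>For \<open>M\<close> with rows \<open>(l, m)\<close> and \<open>(-n, l)\<close>, the matrix \<open>M\<^sup>T M\<close> has trace
  \<open>2l\<^sup>2 + m\<^sup>2 + n\<^sup>2\<close> and its characteristic polynomial
  has discriminant \<open>(m - n)\<^sup>2 (4l\<^sup>2 + (m + n)\<^sup>2)\<close>, so the expression in the
  hypothesis is its largest eigenvalue \<open>e\<close>. The proof shows that the quadratic form of
  \<open>e I - M\<^sup>T M\<close> is nonnegative, which avoids diagonalising \<open>M\<^sup>T M\<close>.\<close>

lemma two_by_two_norm_bound:
  fixes l m n a b E :: real
  assumes "l\<^sup>2 + 1/2 * (m\<^sup>2 + n\<^sup>2 + \<bar>m - n\<bar> * sqrt (4 * l\<^sup>2 + (m + n)\<^sup>2)) \<le> E"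
  shows "(l * a + m * b)\<^sup>2 + (l * b - n * a)\<^sup>2 \<le> E * (a\<^sup>2 + b\<^sup>2)"
proof -
  define s where "s = \<bar>m - n\<bar> * sqrt (4 * l\<^sup>2 + (m + n)\<^sup>2)"
  \<comment> \<open>\<open>p\<close> and \<open>q\<close> are the diagonal entries of \<open>e I - M\<^sup>T M\<close>; its off-diagonal entry is
    \<open>-l (m - n)\<close> and its determinant vanishes.\<close>
  define p where "p = (s + (m\<^sup>2 - n\<^sup>2)) / 2"
  define q where "q = (s - (m\<^sup>2 - n\<^sup>2)) / 2"
  have s2: "s\<^sup>2 = (m - n)\<^sup>2 * (4 * l\<^sup>2 + (m + n)\<^sup>2)"
    by (simp add: s_def power_mult_distrib)
  have "\<bar>m\<^sup>2 - n\<^sup>2\<bar> \<le> s"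
  proof (rule power2_le_imp_le)
    have "s\<^sup>2 = (m\<^sup>2 - n\<^sup>2)\<^sup>2 + (2 * l * (m - n))\<^sup>2" unfolding s2 by algebra
    then show "\<bar>m\<^sup>2 - n\<^sup>2\<bar>\<^sup>2 \<le> s\<^sup>2" by simp
    show "0 \<le> s" by (simp add: s_def)
  qed
  then have "0 \<le> p" "0 \<le> q" by (auto simp: p_def q_def abs_le_iff)
  moreover have "(l * (m - n))\<^sup>2 \<le> p * q"
  proof -
    have "4 * (p * q) = s\<^sup>2 - (m\<^sup>2 - n\<^sup>2)\<^sup>2"
      by (simp add: p_def q_def field_simps power2_eq_square)
    also have "\<dots> = 4 * (l * (m - n))\<^sup>2" unfolding s2 by algebra
    finally show ?thesis by simp
  qed
  ultimately have "0 \<le> p * a\<^sup>2 - 2 * (l * (m - n)) * a * b + q * b\<^sup>2"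
    by (rule binary_quadratic_form_nonneg)
  also have "\<dots> = (l\<^sup>2 + 1/2 * (m\<^sup>2 + n\<^sup>2 + s)) * (a\<^sup>2 + b\<^sup>2)
      - ((l * a + m * b)\<^sup>2 + (l * b - n * a)\<^sup>2)"
    by (simp add: p_def q_def power2_eq_square field_simps)
  finally have "(l * a + m * b)\<^sup>2 + (l * b - n * a)\<^sup>2 \<le> (l\<^sup>2 + 1/2 * (m\<^sup>2 + n\<^sup>2 + s)) * (a\<^sup>2 + b\<^sup>2)"
    by simp
  also have "\<dots> \<le> E * (a\<^sup>2 + b\<^sup>2)"
    using assms by (intro mult_right_mono) (auto simp: s_def)
  finally show ?thesis .
qed

section \<open>The block kernel\<close>

lemma sum_UNIV_Plus:
  fixes f :: "'a::finite + 'b::finite \<Rightarrow> real"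
  shows "sum f UNIV = (\<Sum>a\<in>UNIV. f (Inl a)) + (\<Sum>b\<in>UNIV. f (Inr b))"
  by (simp add: sum.Plus flip: UNIV_Plus_UNIV)

lemma norm_orthogonal_matrix_mult:
  fixes P :: "real^'n^'n"
  assumes "orthogonal_matrix P"
  shows "norm (P *v x) = norm x"
proof -
  have "(P *v x) \<bullet> (P *v x) = ((P *v x) v* P) \<bullet> x"
    by (simp add: dot_lmul_matrix)
  also have "(P *v x) v* P = x"
    using assms by (simp add: orthogonal_matrix_def matrix_vector_mul_assoc flip: transpose_matrix_vector)
  finally show ?thesis by (simp add: norm_eq_sqrt_inner)
qed

theorem proposition4p4:
  fixes K P A B :: "real^'n^'n" and lam mu nu :: "real^'n"
  assumes "pos_semidef K"
    and "orthogonal_matrix P"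
    and "\<And>i. 0 \<le> lam $ i \<and> lam $ i \<le> 1"
    and "K = P ** diag_mat lam ** transpose P"
    and "\<And>i. 0 \<le> mu $ i"
    and "\<And>i. 0 \<le> nu $ i"
    and "\<And>i. (lam $ i - 1/2)\<^sup>2
            + 1/2 * ((mu $ i)\<^sup>2 + (nu $ i)\<^sup>2
                + \<bar>mu $ i - nu $ i\<bar> * sqrt (4 * (lam $ i - 1/2)\<^sup>2 + (mu $ i + nu $ i)\<^sup>2))
            \<le> 1/4"
    and "A = P ** diag_mat mu ** transpose P"
    and "B = - (P ** diag_mat nu ** transpose P)"
  shows "DPP_kernel (block_mat K A B K)"
proof (rule DPP_kernelI_near_half)
  fix v :: "real^('n + 'n)"
  let ?M = "block_mat K A B K - mat (1/2)"
  define x where "x = (\<chi> i. v $ Inl i)"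
  define y where "y = (\<chi> i. v $ Inr i)"
  \<comment> \<open>Coordinates of the two halves of \<open>v\<close> in the eigenbasis of \<open>K\<close>; \<open>f\<close> and \<open>g\<close> below are those of
    its image.\<close>
  define a where "a = transpose P *v x"
  define b where "b = transpose P *v y"
  define f where "f = (\<chi> i. (lam $ i - 1/2) * a $ i + mu $ i * b $ i)"
  define g where "g = (\<chi> i. (lam $ i - 1/2) * b $ i - nu $ i * a $ i)"
  have norm2: "(norm w)\<^sup>2 = (\<Sum>i\<in>UNIV. (w $ i)\<^sup>2)" for w :: "real^'k::finite"
    unfolding power2_norm_eq_inner by (simp add: inner_vec_def power2_eq_square)
  have PT: "orthogonal_matrix (transpose P)"
    using assms(2) by (simp add: orthogonal_matrix_transpose)
  have Pa: "x = P *v a" and Pb: "y = P *v b"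
    using assms(2) by (simp_all add: a_def b_def matrix_vector_mul_assoc orthogonal_matrix_def del: transpose_matrix_vector)
  have diag: "(P ** diag_mat d ** transpose P) *v w = P *v (\<chi> i. d $ i * (transpose P *v w) $ i)" for d w
  proof -
    have "diag_mat d *v u = (\<chi> i. d $ i * u $ i)" for u
      by (simp add: diag_mat_def matrix_vector_mult_def vec_eq_iff if_distrib[of "\<lambda>x. x * _"] cong: if_cong)
    then show ?thesis by (simp flip: matrix_vector_mul_assoc)
  qed
  have spec: "K *v x = P *v (\<chi> i. lam $ i * a $ i)" "K *v y = P *v (\<chi> i. lam $ i * b $ i)"
      "A *v y = P *v (\<chi> i. mu $ i * b $ i)"
    unfolding assms(4,8) diag a_def b_def by (rule refl)+
  have top: "(?M *v v) $ Inl i = (P *v f) $ i" for i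
  proof -
    have "(?M *v v) $ Inl i = (K *v x + A *v y - (1/2) *\<^sub>R x) $ i"
      unfolding matrix_vector_mult_diff_rdistrib mat_vector_mult
      by (simp add: matrix_vector_mult_def sum_UNIV_Plus block_mat_def x_def y_def)
    also have "K *v x + A *v y - (1/2) *\<^sub>R x =
        P *v ((\<chi> i. lam $ i * a $ i) + (\<chi> i. mu $ i * b $ i) - (1/2) *\<^sub>R a)"
      unfolding spec matrix_vector_right_distrib matrix_vector_mult_diff_distrib matrix_vector_mult_scaleR
      by (simp add: Pa[symmetric])
    also have "(\<chi> i. lam $ i * a $ i) + (\<chi> i. mu $ i * b $ i) - (1/2) *\<^sub>R a = f"
      by (simp add: f_def vec_eq_iff algebra_simps)
    finally show ?thesis .
  qed
  have bot: "(?M *v v) $ Inr i = (P *v g) $ i" for i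
  proof -
    have "(?M *v v) $ Inr i = (B *v x + K *v y - (1/2) *\<^sub>R y) $ i"
      unfolding matrix_vector_mult_diff_rdistrib mat_vector_mult
      by (simp add: matrix_vector_mult_def sum_UNIV_Plus block_mat_def x_def y_def)
    also have "B *v x = - (P *v (\<chi> i. nu $ i * a $ i))"
      unfolding assms(9) using diag[of nu x]
      by (simp add: a_def vec_eq_iff matrix_vector_mult_def sum_negf)
    also have "\<dots> + K *v y - (1/2) *\<^sub>R y =
        P *v ((\<chi> i. lam $ i * b $ i) - (\<chi> i. nu $ i * a $ i) - (1/2) *\<^sub>R b)"
      unfolding spec matrix_vector_mult_diff_distrib matrix_vector_mult_scaleR
      by (simp add: Pb[symmetric])
    also have "(\<chi> i. lam $ i * b $ i) - (\<chi> i. nu $ i * a $ i) - (1/2) *\<^sub>R b = g"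
      by (simp add: g_def vec_eq_iff algebra_simps)
    finally show ?thesis .
  qed
  have "(norm (?M *v v))\<^sup>2 = (norm (P *v f))\<^sup>2 + (norm (P *v g))\<^sup>2"
    unfolding norm2 sum_UNIV_Plus top bot ..
  also have "\<dots> = (\<Sum>i\<in>UNIV. (f $ i)\<^sup>2 + (g $ i)\<^sup>2)"
    unfolding norm_orthogonal_matrix_mult[OF assms(2)] norm2 by (rule sum.distrib[symmetric])
  also have "\<dots> \<le> (\<Sum>i\<in>UNIV. 1/4 * ((a $ i)\<^sup>2 + (b $ i)\<^sup>2))"
    unfolding f_def g_def vec_lambda_beta
    by (intro sum_mono two_by_two_norm_bound assms(7))
  also have "\<dots> = 1/4 * ((norm a)\<^sup>2 + (norm b)\<^sup>2)"
    unfolding norm2 sum_distrib_left[symmetric] sum.distrib ..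
  also have "\<dots> = 1/4 * ((norm x)\<^sup>2 + (norm y)\<^sup>2)"
    unfolding a_def b_def norm_orthogonal_matrix_mult[OF PT] ..
  also have "\<dots> = (1/2 * norm v)\<^sup>2"
    by (simp add: power_mult_distrib norm2 sum_UNIV_Plus x_def y_def power_divide)
  finally show "norm (?M *v v) \<le> 1/2 * norm v"
    by (rule power2_le_imp_le) simp
qed

end
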